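(* For every positive integer $n$ and every $1\le i<n$, the statistic on $S_n$ equal to $1$ if $\sigma_i>\sigma_{i+1}$ and $0$ otherwise (the number of descents at position $i$) is $\frac12$-mesic with respect to the Lehmer code rotation.
   Context: A statistic $f$ is $c$-mesic with respect to a bijection $\mathcal{X}$ of a finite set if its average over every orbit of $\mathcal{X}$ equals $c$. Lehmer code: $L(\sigma)_i=\#\{j>i:\sigma_j<\sigma_i\}\in\{0,\dots,n-i\}$, a bijection from $S_n$ to such tuples. The Lehmer code rotation sends $\sigma$ to the unique $\tau$ with $L(\tau)_i\equiv L(\sigma)_i+1\pmod{n-i+1}$ for all $i$. *)

theory Defs
  imports Complex_Main "HOL-Library.FuncSet" "HOL-Combinatorics.Combinatorics" "HOL-Number_Theory.Cong"
begin

definition mesic :: "'a set \<Rightarrow> ('a \<Rightarrow> 'a) \<Rightarrow> ('a \<Rightarrow> real) \<Rightarrow> real \<Rightarrow> bool" where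
  "mesic S X f c \<longleftrightarrow> finite S \<and> bij_betw X S S \<and>
     (\<forall>x\<in>S. (\<Sum>y\<in>orbit X x. f y) / real (card (orbit X x)) = c)"

definition lehmer_code :: "nat \<Rightarrow> (nat \<Rightarrow> nat) \<Rightarrow> nat \<Rightarrow> nat" where
  "lehmer_code n \<sigma> i = card {j \<in> {i<..n}. \<sigma> j < \<sigma> i}"

definition lehmer_rotation :: "nat \<Rightarrow> (nat \<Rightarrow> nat) \<Rightarrow> nat \<Rightarrow> nat" where
  "lehmer_rotation n \<sigma> = (THE \<tau>. \<tau> permutes {1..n} \<and>
     (\<forall>i\<in>{1..n}. [lehmer_code n \<tau> i = lehmer_code n \<sigma> i + 1] (mod (n - i + 1))))"

definition descent_at :: "nat \<Rightarrow> (nat \<Rightarrow> nat) \<Rightarrow> real" where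
  "descent_at i \<sigma> = (if \<sigma> i > \<sigma> (i + 1) then 1 else 0)"

lemma lehmer_code_le: "lehmer_code n \<sigma> i \<le> n - i"
proof -
  have "lehmer_code n \<sigma> i \<le> card {i<..n}"
    unfolding lehmer_code_def by (rule card_mono) auto
  then show ?thesis by simp
qed

lemma lehmer_code_eq_card_values:
  assumes "\<sigma> permutes {1..n}" "i \<in> {1..n}"
  shows "lehmer_code n \<sigma> i = card {x \<in> {1..n} - \<sigma> ` {1..<i}. x < \<sigma> i}"
proof -
  have inj: "inj \<sigma>" using assms(1) by (rule permutes_inj)
  have "\<sigma> ` {j \<in> {i<..n}. \<sigma> j < \<sigma> i} = {x \<in> {1..n} - \<sigma> ` {1..<i}. x < \<sigma> i}" (is "?A = ?B")
  proof
    show "?A \<subseteq> ?B"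
    proof
      fix x assume "x \<in> ?A"
      then obtain j where j: "x = \<sigma> j" "i < j" "j \<le> n" "\<sigma> j < \<sigma> i" by auto
      have "x \<in> {1..n}" using j assms permutes_in_image[OF assms(1), of j] by auto
      moreover have "x \<notin> \<sigma> ` {1..<i}" using j inj by (auto simp: inj_eq)
      ultimately show "x \<in> ?B" using j by auto
    qed
    show "?B \<subseteq> ?A"
    proof
      fix x assume x: "x \<in> ?B"
      then have "x \<in> \<sigma> ` {1..n}" using permutes_image[OF assms(1)] by auto
      then obtain j where j: "x = \<sigma> j" "j \<in> {1..n}" by blast
      have "j \<notin> {1..<i}" using x j by blast
      moreover have "j \<noteq> i" using x j by auto
      ultimately have "i < j" using j by auto
      then show "x \<in> ?A" using x j by auto
    qed
  qed
  moreover have "inj_on \<sigma> {j \<in> {i<..n}. \<sigma> j < \<sigma> i}" using inj by (rule inj_on_subset) simp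
  ultimately show ?thesis unfolding lehmer_code_def using card_image by fastforce
qed

lemma lehmer_code_inject:
  assumes \<sigma>: "\<sigma> permutes {1..n}" and \<tau>: "\<tau> permutes {1..n}"
    and eq: "\<And>i. i \<in> {1..n} \<Longrightarrow> lehmer_code n \<sigma> i = lehmer_code n \<tau> i"
  shows "\<sigma> = \<tau>"
proof -
  have le: "\<beta> i \<le> \<alpha> i"
    if \<alpha>: "\<alpha> permutes {1..n}" and \<beta>: "\<beta> permutes {1..n}" and i: "i \<in> {1..n}"
      and e: "lehmer_code n \<alpha> i = lehmer_code n \<beta> i" and im: "\<alpha> ` {1..<i} = \<beta> ` {1..<i}"
    for \<alpha> \<beta> :: "nat \<Rightarrow> nat" and i
  proof (rule ccontr)
    assume "\<not> \<beta> i \<le> \<alpha> i"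
    then have lt: "\<alpha> i < \<beta> i" by simp
    have "\<alpha> i \<in> {1..n}" using permutes_in_image[OF \<alpha>] i by blast
    moreover have "\<alpha> i \<notin> \<alpha> ` {1..<i}" using permutes_inj[OF \<alpha>] by (auto simp: inj_eq)
    ultimately have m: "\<alpha> i \<in> {x \<in> {1..n} - \<alpha> ` {1..<i}. x < \<beta> i}" using lt by auto
    have "{x \<in> {1..n} - \<alpha> ` {1..<i}. x < \<alpha> i} \<subset> {x \<in> {1..n} - \<alpha> ` {1..<i}. x < \<beta> i}"
    proof (rule psubsetI)
      show "{x \<in> {1..n} - \<alpha> ` {1..<i}. x < \<alpha> i} \<subseteq> {x \<in> {1..n} - \<alpha> ` {1..<i}. x < \<beta> i}"
        using lt by (intro Collect_mono) (meson order.strict_trans)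
      show "{x \<in> {1..n} - \<alpha> ` {1..<i}. x < \<alpha> i} \<noteq> {x \<in> {1..n} - \<alpha> ` {1..<i}. x < \<beta> i}"
        using m by blast
    qed
    then have "card {x \<in> {1..n} - \<alpha> ` {1..<i}. x < \<alpha> i}
        < card {x \<in> {1..n} - \<alpha> ` {1..<i}. x < \<beta> i}"
      by (intro psubset_card_mono) auto
    then show False
      using e lehmer_code_eq_card_values[OF \<alpha> i] lehmer_code_eq_card_values[OF \<beta> i] im by simp
  qed
  have *: "i \<in> {1..n} \<longrightarrow> \<sigma> i = \<tau> i" for i
  proof (induction i rule: less_induct)
    case (less i)
    show ?case
    proof
      assume i: "i \<in> {1..n}"
      have im: "\<sigma> ` {1..<i} = \<tau> ` {1..<i}" using less i by (intro image_cong) auto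
      show "\<sigma> i = \<tau> i"
        using le[OF \<sigma> \<tau> i eq[OF i] im] le[OF \<tau> \<sigma> i eq[OF i, symmetric] im[symmetric]] by simp
    qed
  qed
  show ?thesis
  proof
    fix i show "\<sigma> i = \<tau> i"
      using * permutes_not_in[OF \<sigma>, of i] permutes_not_in[OF \<tau>, of i] by (cases "i \<in> {1..n}") auto
  qed
qed

lemma prod_lehmer_eq_fact: "(\<Prod>i\<in>{1..n}. Suc (n - i)) = fact n"
proof -
  have "(\<Prod>i\<in>{1..n}. Suc (n - i)) = (\<Prod>i\<in>{1..n}. i)"
    by (rule prod.reindex_bij_witness[of _ "\<lambda>i. Suc n - i" "\<lambda>i. Suc n - i"]) auto
  then show ?thesis by (simp add: fact_prod)
qed

lemma bij_betw_lehmer_code: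
  "bij_betw (\<lambda>\<sigma>. restrict (lehmer_code n \<sigma>) {1..n})
     {\<sigma>. \<sigma> permutes {1..n}} (\<Pi>\<^sub>E i\<in>{1..n}. {0..n - i})"
proof -
  let ?F = "\<lambda>\<sigma>. restrict (lehmer_code n \<sigma>) {1..n}"
  let ?S = "{\<sigma>. \<sigma> permutes {1..n}}" and ?T = "\<Pi>\<^sub>E i\<in>{1..n}. {0..n - i}"
  have inj: "inj_on ?F ?S"
  proof (rule inj_onI)
    fix \<sigma> \<tau> assume a: "\<sigma> \<in> ?S" "\<tau> \<in> ?S" "?F \<sigma> = ?F \<tau>"
    show "\<sigma> = \<tau>"
    proof (rule lehmer_code_inject)
      show "\<sigma> permutes {1..n}" "\<tau> permutes {1..n}" using a by auto
      show "lehmer_code n \<sigma> i = lehmer_code n \<tau> i" if "i \<in> {1..n}" for i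
        using fun_cong[OF a(3), of i] that by simp
    qed
  qed
  have sub: "?F ` ?S \<subseteq> ?T" using lehmer_code_le by (fastforce simp: PiE_iff)
  have fin: "finite ?T" by (intro finite_PiE) auto
  have "card ?T = fact n" using prod_lehmer_eq_fact[of n] by (simp add: card_PiE)
  moreover have "card (?F ` ?S) = fact n"
    using card_image[OF inj] card_permutations[of "{1..n}" n] by simp
  ultimately have "?F ` ?S = ?T" using card_subset_eq[OF fin sub] by simp
  then show ?thesis using inj by (simp add: bij_betw_def)
qed

lemma lehmer_rotation_ex1:
  "\<exists>!\<tau>. \<tau> permutes {1..n} \<and>
     (\<forall>i\<in>{1..n}. [lehmer_code n \<tau> i = lehmer_code n \<sigma> i + 1] (mod (n - i + 1)))"
proof -
  let ?c = "\<lambda>i\<in>{1..n}. (lehmer_code n \<sigma> i + 1) mod (n - i + 1)"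
  have "?c \<in> (\<Pi>\<^sub>E i\<in>{1..n}. {0..n - i})"
    by (auto simp: less_Suc_eq_le[symmetric])
  then obtain \<tau> where \<tau>: "\<tau> permutes {1..n}" "restrict (lehmer_code n \<tau>) {1..n} = ?c"
    using bij_betw_imp_surj_on[OF bij_betw_lehmer_code[of n]] by (metis (no_types, lifting) imageE mem_Collect_eq)
  have code: "lehmer_code n \<tau> i = (lehmer_code n \<sigma> i + 1) mod (n - i + 1)" if "i \<in> {1..n}" for i
    using fun_cong[OF \<tau>(2), of i] that by simp
  show ?thesis
  proof (rule ex1I[of _ \<tau>], intro conjI ballI)
    show "\<tau> permutes {1..n}" by (fact \<tau>)
    show "[lehmer_code n \<tau> i = lehmer_code n \<sigma> i + 1] (mod (n - i + 1))" if "i \<in> {1..n}" for i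
      using code[OF that] by (simp add: cong_def)
  next
    fix \<rho> assume \<rho>: "\<rho> permutes {1..n} \<and>
      (\<forall>i\<in>{1..n}. [lehmer_code n \<rho> i = lehmer_code n \<sigma> i + 1] (mod (n - i + 1)))"
    show "\<rho> = \<tau>"
    proof (rule lehmer_code_inject)
      show "\<rho> permutes {1..n}" "\<tau> permutes {1..n}" using \<rho> \<tau> by auto
      fix i assume i: "i \<in> {1..n}"
      have "lehmer_code n \<rho> i < n - i + 1" using lehmer_code_le[of n \<rho> i] by simp
      then show "lehmer_code n \<rho> i = lehmer_code n \<tau> i"
        using \<rho> i code[OF i] unfolding cong_def by (metis mod_less)
    qed
  qed
qed

end

theory Submission
  imports Defs
begin

text \<open>
  A permutation \<open>\<sigma>\<close> has a descent at \<open>i\<close> iff \<open>L(\<sigma>)\<^sub>i > L(\<sigma>)\<^sub>i\<^sub>+\<^sub>1\<close>. Put \<open>m = n - i\<close>. The rotation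
  advances these two entries in \<open>\<int>/(m + 1)\<close> and \<open>\<int>/m\<close>; as the moduli are coprime, every pair of
  entries is visited equally often along an orbit. Of the \<open>m (m + 1)\<close> pairs \<open>(a, b)\<close>, exactly
  half satisfy \<open>a > b\<close>.
\<close>

lemma lehmer_rotation_permutes: "lehmer_rotation n \<sigma> permutes {1..n}"
  using theI'[OF lehmer_rotation_ex1[of n \<sigma>]] unfolding lehmer_rotation_def by blast

text \<open>Both sides lie below the modulus, so the defining congruence becomes an
  equation.\<close>

lemma lehmer_code_rotation:
  assumes "j \<in> {1..n}"
  shows "lehmer_code n (lehmer_rotation n \<sigma>) j = (lehmer_code n \<sigma> j + 1) mod (n - j + 1)"
proof -
  have "[lehmer_code n (lehmer_rotation n \<sigma>) j = lehmer_code n \<sigma> j + 1] (mod (n - j + 1))"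
    using theI'[OF lehmer_rotation_ex1[of n \<sigma>]] assms unfolding lehmer_rotation_def by blast
  moreover have "lehmer_code n (lehmer_rotation n \<sigma>) j < n - j + 1"
    using lehmer_code_le[of n "lehmer_rotation n \<sigma>" j] by simp
  ultimately show ?thesis by (simp add: cong_def)
qed

lemma funpow_lehmer_rotation_permutes:
  assumes "\<sigma> permutes {1..n}"
  shows "(lehmer_rotation n ^^ k) \<sigma> permutes {1..n}"
  using assms by (cases k) (simp_all add: lehmer_rotation_permutes del: One_nat_def)

lemma lehmer_code_funpow_rotation:
  assumes "j \<in> {1..n}"
  shows "lehmer_code n ((lehmer_rotation n ^^ k) \<sigma>) j = (lehmer_code n \<sigma> j + k) mod (n - j + 1)"
proof (induction k)
  case 0
  show ?case using lehmer_code_le[of n \<sigma> j] by simp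
next
  case (Suc k)
  then show ?case using assms by (simp add: lehmer_code_rotation mod_Suc_eq)
qed

text \<open>Each modulus \<open>n - j + 1\<close> lies between 1 and \<open>n\<close> and so divides
  \<open>fact n\<close>; after that many steps every code entry is back at its start.\<close>

lemma funpow_lehmer_rotation_fact:
  assumes "\<sigma> permutes {1..n}"
  shows "(lehmer_rotation n ^^ fact n) \<sigma> = \<sigma>"
proof (rule lehmer_code_inject[OF funpow_lehmer_rotation_permutes[OF assms] assms])
  fix j assume j: "j \<in> {1..n}"
  then have "n - j + 1 dvd fact n" by (intro dvd_fact) auto
  then have "(lehmer_code n \<sigma> j + fact n) mod (n - j + 1) = lehmer_code n \<sigma> j mod (n - j + 1)"
    by (metis add.right_neutral dvd_eq_mod_eq_0 mod_add_right_eq)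
  also have "\<dots> = lehmer_code n \<sigma> j" using lehmer_code_le[of n \<sigma> j] by simp
  finally show "lehmer_code n ((lehmer_rotation n ^^ fact n) \<sigma>) j = lehmer_code n \<sigma> j"
    using lehmer_code_funpow_rotation[OF j] by simp
qed

text \<open>\<open>orbit\<close> collects only the iterates with positive exponent, so this
  expresses that the rotation returns to its start.\<close>

lemma self_in_orbit_lehmer_rotation:
  assumes "\<sigma> permutes {1..n}"
  shows "\<sigma> \<in> orbit (lehmer_rotation n) \<sigma>"
  unfolding orbit_altdef using funpow_lehmer_rotation_fact[OF assms]
  by (metis (mono_tags, lifting) fact_gt_zero mem_Collect_eq)

lemma bij_betw_lehmer_rotation:
  "bij_betw (lehmer_rotation n) {\<sigma>. \<sigma> permutes {1..n}} {\<sigma>. \<sigma> permutes {1..n}}"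
\<comment> \<open>The \<open>fact n\<close>-th iterate fixes every permutation, so the preceding
  iterate is a two-sided inverse.\<close>
proof (rule bij_betw_byWitness[where f' = "lehmer_rotation n ^^ (fact n - 1)"])
  have fact_eq: "Suc (fact n - 1) = fact n" by simp
  show "\<forall>\<sigma>\<in>{\<sigma>. \<sigma> permutes {1..n}}. (lehmer_rotation n ^^ (fact n - 1)) (lehmer_rotation n \<sigma>) = \<sigma>"
    using funpow_lehmer_rotation_fact fact_eq by (metis comp_apply funpow_Suc_right mem_Collect_eq)
  show "\<forall>\<sigma>\<in>{\<sigma>. \<sigma> permutes {1..n}}. lehmer_rotation n ((lehmer_rotation n ^^ (fact n - 1)) \<sigma>) = \<sigma>"
    using funpow_lehmer_rotation_fact fact_eq by (metis comp_apply funpow.simps(2) mem_Collect_eq)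
qed (use lehmer_rotation_permutes funpow_lehmer_rotation_permutes in blast)+

text \<open>At a descent, every position counted for \<open>i + 1\<close> is also counted for
  \<open>i\<close>, and \<open>i + 1\<close> itself is counted in addition. Without a descent,
  \<open>i + 1\<close> is not counted for \<open>i\<close> and the inclusion is reversed.\<close>

lemma descent_iff_lehmer_code:
  assumes "i < n"
  shows "\<sigma> (i + 1) < \<sigma> i \<longleftrightarrow> lehmer_code n \<sigma> (i + 1) < lehmer_code n \<sigma> i"
proof
  assume d: "\<sigma> (i + 1) < \<sigma> i"
  have "{j \<in> {i + 1<..n}. \<sigma> j < \<sigma> (i + 1)} \<subset> {j \<in> {i<..n}. \<sigma> j < \<sigma> i}"
  proof (rule psubsetI)
    show "{j \<in> {i + 1<..n}. \<sigma> j < \<sigma> (i + 1)} \<subseteq> {j \<in> {i<..n}. \<sigma> j < \<sigma> i}" using d by auto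
    have "i + 1 \<in> {j \<in> {i<..n}. \<sigma> j < \<sigma> i}" using d assms by simp
    then show "{j \<in> {i + 1<..n}. \<sigma> j < \<sigma> (i + 1)} \<noteq> {j \<in> {i<..n}. \<sigma> j < \<sigma> i}" by blast
  qed
  then show "lehmer_code n \<sigma> (i + 1) < lehmer_code n \<sigma> i"
    unfolding lehmer_code_def by (intro psubset_card_mono) auto
next
  assume c: "lehmer_code n \<sigma> (i + 1) < lehmer_code n \<sigma> i"
  show "\<sigma> (i + 1) < \<sigma> i"
  proof (rule ccontr)
    assume a: "\<not> \<sigma> (i + 1) < \<sigma> i"
    have "{j \<in> {i<..n}. \<sigma> j < \<sigma> i} \<subseteq> {j \<in> {i + 1<..n}. \<sigma> j < \<sigma> (i + 1)}"
    proof
      fix j assume j: "j \<in> {j \<in> {i<..n}. \<sigma> j < \<sigma> i}"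
      then have "j \<noteq> i + 1" using a by auto
      then show "j \<in> {j \<in> {i + 1<..n}. \<sigma> j < \<sigma> (i + 1)}" using j a by auto
    qed
    then have "lehmer_code n \<sigma> i \<le> lehmer_code n \<sigma> (i + 1)"
      unfolding lehmer_code_def by (intro card_mono) auto
    then show False using c by simp
  qed
qed

text \<open>Chinese remainder theorem with arbitrary starting residues: coprimality gives
  injectivity, and equal cardinalities give surjectivity.\<close>

lemma bij_betw_shifted_residues:
  fixes p q a b :: nat
  assumes "coprime p q" "0 < p" "0 < q"
  shows "bij_betw (\<lambda>k. ((a + k) mod p, (b + k) mod q)) {..<p * q} ({..<p} \<times> {..<q})"
proof -
  let ?h = "\<lambda>k. ((a + k) mod p, (b + k) mod q)"
  have inj: "inj_on ?h {..<p * q}"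
  proof (rule inj_onI)
    fix k l assume kl: "k \<in> {..<p * q}" "l \<in> {..<p * q}" "?h k = ?h l"
    then have "[a + k = a + l] (mod p)" "[b + k = b + l] (mod q)" by (auto simp: cong_def)
    then have "[k = l] (mod p * q)"
      using assms(1) by (simp add: cong_add_lcancel_nat coprime_cong_mult_nat)
    then show "k = l" using kl by (simp add: cong_less_modulus_unique_nat)
  qed
  moreover have "?h ` {..<p * q} = {..<p} \<times> {..<q}"
  proof (rule card_subset_eq)
    show "?h ` {..<p * q} \<subseteq> {..<p} \<times> {..<q}" using assms by auto
    show "card (?h ` {..<p * q}) = card ({..<p} \<times> {..<q})" using card_image[OF inj] by simp
  qed simp
  ultimately show ?thesis by (simp add: bij_betw_def)
qed

lemma sum_greater_pairs:
  "(\<Sum>(a, b)\<in>{..<Suc m} \<times> {..<m}. if b < a then 1 else 0 :: real) = real (Suc m * m) / 2"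
proof -
  have "(\<Sum>(a, b)\<in>{..<Suc m} \<times> {..<m}. if b < a then 1 else 0 :: real)
      = (\<Sum>a<Suc m. \<Sum>b<m. if b < a then 1 else 0)"
    by (simp add: sum.cartesian_product)
  also have "\<dots> = (\<Sum>a<Suc m. real a)"
  proof (rule sum.cong)
    fix a assume "a \<in> {..<Suc m}"
    \<comment> \<open>Since a \<le> m, no value below \<open>a\<close> is cut off, and the inner sum
      is exactly \<open>a\<close>.\<close>
    then have "{..<m} \<inter> {b. b < a} = {..<a}" by auto
    then show "(\<Sum>b<m. if b < a then 1 else 0) = real a" by (simp add: sum.If_cases)
  qed simp
  also have "\<dots> = real (Suc m * m) / 2"
    by (induction m) (simp_all add: field_simps)
  finally show ?thesis .
qed

text \<open>The range splits into \<open>c\<close> blocks of length \<open>M\<close>, each a shifted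
  copy of the first.\<close>

lemma sum_periodic:
  fixes g :: "nat \<Rightarrow> 'a::comm_semiring_1"
  assumes "\<And>k. g (k + M) = g k"
  shows "sum g {..<c * M} = of_nat c * sum g {..<M}"
proof (induction c)
  case (Suc c)
  have shift: "g (k + c * M) = g k" for k
    by (induction c) (use assms in \<open>simp_all add: add.assoc[symmetric] add.commute[of M]\<close>)
  have "sum g {..<Suc c * M} = sum g {..<c * M} + sum g {c * M..<c * M + M}"
    by (simp add: lessThan_atLeast0 sum.atLeastLessThan_concat add.commute)
  also have "sum g {c * M..<c * M + M} = sum g {..<M}"
    using sum.shift_bounds_nat_ivl[of g 0 "c * M" M] shift
    by (simp add: lessThan_atLeast0 add.commute)
  finally show ?case using Suc by (simp add: algebra_simps)
qed simp

theorem theorem4p18: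
  fixes n i :: nat
  assumes "0 < n" and "1 \<le> i" and "i < n"
  shows "mesic {\<sigma>. \<sigma> permutes {1..n}} (lehmer_rotation n) (descent_at i) (1 / 2)"
  unfolding mesic_def
proof (intro conjI ballI)
  show "finite {\<sigma>. \<sigma> permutes {1..n}}" by (simp add: finite_permutations)
  show "bij_betw (lehmer_rotation n) {\<sigma>. \<sigma> permutes {1..n}} {\<sigma>. \<sigma> permutes {1..n}}"
    by (rule bij_betw_lehmer_rotation)
  fix \<sigma> assume "\<sigma> \<in> {\<sigma>. \<sigma> permutes {1..n}}"
  then have \<sigma>: "\<sigma> permutes {1..n}" by simp
  define X where "X = lehmer_rotation n"
  define m where "m = n - i"
  \<comment> \<open>The orbit length: the least positive number of steps from \<sigma> back to
    itself.\<close>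
  define N where "N = funpow_dist1 X \<sigma> \<sigma>"
  define a where "a = lehmer_code n \<sigma> i"
  define b where "b = lehmer_code n \<sigma> (i + 1)"
  \<comment> \<open>The descent indicator along the orbit, in terms of the two code entries alone;
    their moduli are \<open>n - i + 1 = Suc m\<close> and
    \<open>n - (i + 1) + 1 = m\<close>.\<close>
  define g :: "nat \<Rightarrow> real"
    where "g k = (if (b + k) mod m < (a + k) mod Suc m then 1 else 0)" for k
  have m: "0 < m" using assms by (simp add: m_def)
  have self: "\<sigma> \<in> orbit X \<sigma>" unfolding X_def using \<sigma> by (rule self_in_orbit_lehmer_rotation)
  have code_i: "lehmer_code n ((X ^^ k) \<sigma>) i = (a + k) mod Suc m" for k
    using lehmer_code_funpow_rotation[of i n k \<sigma>] assms by (simp add: X_def a_def m_def)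
  have code_Suc_i: "lehmer_code n ((X ^^ k) \<sigma>) (i + 1) = (b + k) mod m" for k
    using lehmer_code_funpow_rotation[of "i + 1" n k \<sigma>] assms
    by (simp add: X_def b_def m_def Suc_diff_Suc)
  have descent: "descent_at i ((X ^^ k) \<sigma>) = g k" for k
    using descent_iff_lehmer_code[OF assms(3), of "(X ^^ k) \<sigma>"] code_i[of k] code_Suc_i[of k]
    by (simp add: descent_at_def g_def)
  have inj: "inj_on (\<lambda>k. (X ^^ k) \<sigma>) {..<N}"
    using inj_on_funpow_dist1[OF self] by (simp add: N_def lessThan_atLeast0)
  have orbit: "orbit X \<sigma> = (\<lambda>k. (X ^^ k) \<sigma>) ` {..<N}"
    using orbit_conv_funpow_dist1[OF self] by (simp add: N_def lessThan_atLeast0)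
  have N: "0 < N" by (simp add: N_def)
  have return: "(X ^^ N) \<sigma> = \<sigma>" unfolding N_def by (rule funpow_dist1_prop[OF self])
  \<comment> \<open>A return after \<open>N\<close> steps restores both entries, so both moduli
    divide \<open>N\<close>; being consecutive they are coprime, so their product divides
    \<open>N\<close>.\<close>
  have "[a + N = a + 0] (mod Suc m)"
    using code_i[of N] code_i[of 0] return by (simp add: cong_def)
  then have "Suc m dvd N" by (simp only: cong_add_lcancel_nat cong_0_iff)
  moreover have "[b + N = b + 0] (mod m)"
    using code_Suc_i[of N] code_Suc_i[of 0] return by (simp add: cong_def)
  then have "m dvd N" by (simp only: cong_add_lcancel_nat cong_0_iff)
  ultimately have "Suc m * m dvd N" by (intro divides_mult) auto
  then obtain c where c: "N = c * (Suc m * m)" by (metis dvd_def mult.commute)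
  have period: "g (k + Suc m * m) = g k" for k
  proof -
    have "(a + (k + Suc m * m)) mod Suc m = (a + k) mod Suc m"
      by (metis add.assoc mod_mult_self2)
    moreover have "(b + (k + Suc m * m)) mod m = (b + k) mod m"
      by (metis add.assoc mod_mult_self3 mult.commute mod_mult_self2)
    ultimately show ?thesis by (simp only: g_def)
  qed
  \<comment> \<open>Over one period of \<open>g\<close> the pair of entries runs through each pair
    of residues exactly once.\<close>
  have "sum g {..<Suc m * m}
      = (\<Sum>(a, b)\<in>{..<Suc m} \<times> {..<m}. if b < a then 1 else 0 :: real)"
    using sum.reindex_bij_betw[OF bij_betw_shifted_residues[of "Suc m" m a b],
        of "\<lambda>(a, b). if b < a then 1 else 0 :: real"] m
    by (simp add: g_def)
  also have "\<dots> = real (Suc m * m) / 2" by (rule sum_greater_pairs)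
  \<comment> \<open>The orbit consists of \<open>c\<close> full periods, so the average over one
    period carries over.\<close>
  finally have "sum g {..<N} = real N / 2"
    using sum_periodic[of g "Suc m * m" c, OF period] c by simp
  then show "(\<Sum>\<tau>\<in>orbit (lehmer_rotation n) \<sigma>. descent_at i \<tau>) /
      real (card (orbit (lehmer_rotation n) \<sigma>)) = 1 / 2"
    using N orbit descent card_image[OF inj] by (simp add: X_def[symmetric] sum.reindex[OF inj])
qed

end
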